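(* A Banach space $X$ has the Grothendieck property if and only if $G(X)=0$.
   Context: Banach spaces are infinite-dimensional, over the real or complex field; $B_{X^*}$ denotes the closed unit ball of $X^*$. $X$ has the Grothendieck property (is a Grothendieck space) if every weak$^*$ convergent sequence in $X^*$ converges weakly. A sequence $(y_n)_{n=1}^\infty$ is a convex block subsequence of $(x_n)_{n=1}^\infty$ if there is a strictly increasing sequence of positive integers $(k_n)_{n=1}^\infty$ such that, with $k_0=0$, $y_n\in\operatorname{conv}\{x_i: k_{n-1}+1\leqslant i\leqslant k_n\}$ for every $n\in\mathbb N$. The collection of all convex block subsequences of $(x_n)$ is denoted $\operatorname{cbs}((x_n)_{n=1}^\infty)$. Define $$G(X)=\sup_{(f_n)}\ \inf_{(g_n)\in\operatorname{cbs}((f_n))}\limsup_{n\to\infty}\|g_n\|,$$ where the supremum is over all weak$^*$ null sequences $(f_n)_{n=1}^\infty$ in $B_{X^*}$. *)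

theory Defs
  imports "HOL-Analysis.Analysis"
begin

text \<open>
  Only real scalars are built into the class \<open>banach\<close>. A Banach space over \<open>'k\<close> (used below with
  \<open>'k = real\<close> and \<open>'k = complex\<close>) is a real Banach space together with a multiplication by
  scalars from \<open>'k\<close> that extends \<open>scaleR\<close> and for which the norm is homogeneous.
\<close>

locale banach_over = vector_space sc
  for sc :: "'k::real_normed_field \<Rightarrow> 'a::banach \<Rightarrow> 'a" +
  assumes sc_of_real: "sc (of_real r) x = r *\<^sub>R x"
    and norm_sc: "norm (sc c x) = norm c * norm x"

lemma banach_over_scaleR: "banach_over (scaleR :: real \<Rightarrow> 'a::banach \<Rightarrow> 'a)"
  by unfold_locales (auto simp: algebra_simps)

definition infinite_dimensional :: "('k::real_normed_field \<Rightarrow> 'a::banach \<Rightarrow> 'a) \<Rightarrow> bool" where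
  "infinite_dimensional sc \<longleftrightarrow> \<not> (\<exists>B. finite B \<and> module.span sc B = UNIV)"

text \<open>
  The elements of \<open>'a \<Rightarrow>\<^sub>L 'k\<close> are only real-linear, so the dual is the subspace of the
  \<open>'k\<close>-linear ones, with the operator norm of \<open>'a \<Rightarrow>\<^sub>L 'k\<close>.
\<close>

definition dual :: "('k::real_normed_field \<Rightarrow> 'a::banach \<Rightarrow> 'a) \<Rightarrow> ('a \<Rightarrow>\<^sub>L 'k) set" where
  "dual sc = {f. \<forall>c x. blinfun_apply f (sc c x) = c * blinfun_apply f x}"

text \<open>
  Bounded \<open>'k\<close>-linear functionals on the dual; the composition with \<open>blinfun_mult_right c\<close> is
  the scalar multiple \<open>x \<mapsto> c * f x\<close>. Values outside \<open>dual sc\<close> are arbitrary and never used.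
\<close>

definition bidual ::
    "('k::real_normed_field \<Rightarrow> 'a::banach \<Rightarrow> 'a) \<Rightarrow> (('a \<Rightarrow>\<^sub>L 'k) \<Rightarrow> 'k) set" where
  "bidual sc = {\<phi>.
     (\<forall>f\<in>dual sc. \<forall>g\<in>dual sc. \<phi> (f + g) = \<phi> f + \<phi> g) \<and>
     (\<forall>c. \<forall>f\<in>dual sc. \<phi> (blinfun_mult_right c o\<^sub>L f) = c * \<phi> f) \<and>
     (\<exists>C. \<forall>f\<in>dual sc. norm (\<phi> f) \<le> C * norm f)}"

definition weak_star_lim ::
    "(nat \<Rightarrow> 'a::banach \<Rightarrow>\<^sub>L 'k::real_normed_field) \<Rightarrow> ('a \<Rightarrow>\<^sub>L 'k) \<Rightarrow> bool" where
  "weak_star_lim f l \<longleftrightarrow> (\<forall>x. (\<lambda>n. blinfun_apply (f n) x) \<longlonglongrightarrow> blinfun_apply l x)"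

definition weak_lim ::
    "('k::real_normed_field \<Rightarrow> 'a::banach \<Rightarrow> 'a) \<Rightarrow> (nat \<Rightarrow> 'a \<Rightarrow>\<^sub>L 'k) \<Rightarrow> ('a \<Rightarrow>\<^sub>L 'k) \<Rightarrow> bool" where
  "weak_lim sc f l \<longleftrightarrow> (\<forall>\<phi>\<in>bidual sc. (\<lambda>n. \<phi> (f n)) \<longlonglongrightarrow> \<phi> l)"

definition grothendieck_space :: "('k::real_normed_field \<Rightarrow> 'a::banach \<Rightarrow> 'a) \<Rightarrow> bool" where
  "grothendieck_space sc \<longleftrightarrow>
     (\<forall>f. range f \<subseteq> dual sc \<and> (\<exists>l\<in>dual sc. weak_star_lim f l) \<longrightarrow>
          (\<exists>l\<in>dual sc. weak_lim sc f l))"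

text \<open>
  Sequences are indexed from 0: the block \<open>k\<^sub>n\<^sub>-\<^sub>1 + 1 \<le> i \<le> k\<^sub>n\<close> of a sequence indexed from 1
  becomes \<open>{k n..<k (Suc n)}\<close>.
\<close>

definition cbs :: "(nat \<Rightarrow> 'v::real_vector) \<Rightarrow> (nat \<Rightarrow> 'v) set" where
  "cbs x = {y. \<exists>k::nat \<Rightarrow> nat. strict_mono k \<and> k 0 = 0 \<and>
                 (\<forall>n. y n \<in> convex hull (x ` {k n..<k (Suc n)}))}"

definition weak_star_null_ball ::
    "('k::real_normed_field \<Rightarrow> 'a::banach \<Rightarrow> 'a) \<Rightarrow> (nat \<Rightarrow> 'a \<Rightarrow>\<^sub>L 'k) set" where
  "weak_star_null_ball sc = {f. range f \<subseteq> dual sc \<inter> cball 0 1 \<and> weak_star_lim f 0}"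

definition G_const :: "('k::real_normed_field \<Rightarrow> 'a::banach \<Rightarrow> 'a) \<Rightarrow> ereal" where
  "G_const sc =
     (SUP f \<in> weak_star_null_ball sc. INF g \<in> cbs f. limsup (\<lambda>n. ereal (norm (g n))))"

end

theory Submission
  imports Defs
begin

text \<open>
  If \<open>X\<close> is a Grothendieck space, weak* null sequences are weakly null, so by Mazur's lemma
  each of them has convex block subsequences that converge to 0 in norm. Conversely, if a bounded
  weak* null sequence is not weakly null, then some \<open>\<phi>\<close> in the bidual maps a subsequence
  into a ball that stays away from 0; balls are convex, so the norms of the convex blocks of that
  subsequence are bounded away from 0.

  The Hahn-Banach theorem is obtained from Zorn's lemma: a minimal sublinear functional is odd, and
  hence linear.
\<close>

section \<open>Sublinear functionals and the Hahn-Banach theorem\<close>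

definition sublinear :: "('v::real_vector \<Rightarrow> real) \<Rightarrow> bool" where
  "sublinear p \<longleftrightarrow> (\<forall>x y. p (x + y) \<le> p x + p y) \<and> (\<forall>r\<ge>0. \<forall>x. p (r *\<^sub>R x) = r * p x)"

text \<open>Only one inequality for positive scalars has to be checked: the reverse one is the same
  inequality for \<open>inverse r\<close> at the point \<open>r *\<^sub>R x\<close>.\<close>

lemma sublinearI:
  assumes add: "\<And>x y. p (x + y) \<le> p x + p y"
    and scale: "\<And>r x. r > 0 \<Longrightarrow> p (r *\<^sub>R x) \<le> r * p x"
    and zero: "p 0 = 0"
  shows "sublinear p"
  unfolding sublinear_def
proof (intro conjI allI impI add)
  fix r :: real and x
  assume "r \<ge> 0"
  show "p (r *\<^sub>R x) = r * p x"
  proof (cases "r = 0")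
    case False
    with \<open>r \<ge> 0\<close> have r: "r > 0" by simp
    have "p (inverse r *\<^sub>R r *\<^sub>R x) \<le> inverse r * p (r *\<^sub>R x)"
      using r by (intro scale) auto
    hence "r * p x \<le> p (r *\<^sub>R x)"
      using r by (simp add: field_simps)
    with scale[OF r, of x] show ?thesis by simp
  qed (simp add: zero)
qed

lemma sublinear_add: "sublinear p \<Longrightarrow> p (x + y) \<le> p x + p y"
  by (simp add: sublinear_def)

lemma sublinear_scale: "sublinear p \<Longrightarrow> r \<ge> 0 \<Longrightarrow> p (r *\<^sub>R x) = r * p x"
  by (simp add: sublinear_def)

lemma sublinear_zero: "sublinear p \<Longrightarrow> p 0 = 0"
  using sublinear_scale[of p 0 0] by simp

lemma sublinear_minus: "sublinear p \<Longrightarrow> - p (- x) \<le> p x"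
  using sublinear_add[of p x "- x"] sublinear_zero[of p] by simp

lemma sublinear_norm: "sublinear norm"
  by (intro sublinearI) (auto intro: norm_triangle_ineq)

text \<open>Oddness turns subadditivity at \<open>- x\<close> and \<open>- y\<close> into
  superadditivity at \<open>x\<close> and \<open>y\<close>, and carries homogeneity over to negative
  scalars.\<close>

lemma sublinear_odd_imp_linear:
  assumes p: "sublinear p" and odd: "\<And>x. p (- x) \<le> - p x"
  shows "linear p"
proof -
  have neg: "p (- x) = - p x" for x
    using odd[of x] sublinear_minus[OF p, of x] by simp
  show ?thesis
  proof (rule linearI)
    fix x y
    have "p (- x + - y) \<le> - p x - p y"
      using sublinear_add[OF p, of "- x" "- y"] by (simp add: neg)
    moreover have "p (- x + - y) = - p (x + y)"
      using neg[of "x + y"] by (simp add: add.commute)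
    ultimately show "p (x + y) = p x + p y"
      using sublinear_add[OF p, of x y] by simp
  next
    fix r x
    show "p (r *\<^sub>R x) = r *\<^sub>R p x"
    proof (cases "r \<ge> 0")
      case True
      then show ?thesis by (simp add: sublinear_scale[OF p])
    next
      case False
      then have "p ((- r) *\<^sub>R x) = (- r) * p x"
        by (intro sublinear_scale[OF p]) auto
      then show ?thesis using neg[of "r *\<^sub>R x"] by simp
    qed
  qed
qed

text \<open>Supplies the bounds of chains for Zorn's lemma. The infimum is finite because every
  \<open>q\<close> in the chain satisfies
  \<open>- p (- x) \<le> - q (- x) \<le> q x\<close>.\<close>

lemma sublinear_INF_chain:
  assumes ne: "C \<noteq> {}"
    and sub: "\<And>q. q \<in> C \<Longrightarrow> sublinear q"
    and le: "\<And>q x. q \<in> C \<Longrightarrow> q x \<le> p x"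
    and chain: "\<And>q r. q \<in> C \<Longrightarrow> r \<in> C \<Longrightarrow> (\<forall>x. q x \<le> r x) \<or> (\<forall>x. r x \<le> q x)"
  shows "sublinear (\<lambda>x. INF q\<in>C. q x)" "\<And>q x. q \<in> C \<Longrightarrow> (INF q\<in>C. q x) \<le> q x"
proof -
  have bdd: "bdd_below ((\<lambda>q. q x) ` C)" for x
  proof (rule bdd_belowI2)
    fix q assume "q \<in> C"
    then show "- p (- x) \<le> q x"
      using sublinear_minus[OF sub, of q x] le[of q "- x"] by simp
  qed
  show low: "(INF q\<in>C. q x) \<le> q x" if "q \<in> C" for q x
    by (rule cINF_lower[OF bdd that])
  show "sublinear (\<lambda>x. INF q\<in>C. q x)"
  proof (rule sublinearI)
    fix x y
    \<comment> \<open>The values at \<open>x\<close> and at \<open>y\<close> may come from different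
      members of the chain; the smaller of the two members, \<open>s\<close>, serves both
      points.\<close>
    have *: "(INF q\<in>C. q (x + y)) \<le> q x + r y" if q: "q \<in> C" and r: "r \<in> C" for q r
    proof -
      from chain[OF q r] obtain s where s: "s \<in> C" "s x \<le> q x" "s y \<le> r y"
        using q r by blast
      show ?thesis
        using low[OF s(1), of "x + y"] sublinear_add[OF sub[OF s(1)], of x y] s by linarith
    qed
    have "(INF q\<in>C. q (x + y)) - q x \<le> (INF r\<in>C. r y)" if "q \<in> C" for q
      using *[OF that] by (intro cINF_greatest[OF ne]) (simp add: algebra_simps)
    then have "(INF q\<in>C. q (x + y)) - (INF r\<in>C. r y) \<le> (INF q\<in>C. q x)"
      by (intro cINF_greatest[OF ne]) (simp add: algebra_simps)
    then show "(INF q\<in>C. q (x + y)) \<le> (INF q\<in>C. q x) + (INF q\<in>C. q y)"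
      by simp
  next
    fix r :: real and x assume r: "r > 0"
    have "(INF q\<in>C. q (r *\<^sub>R x)) / r \<le> q x" if "q \<in> C" for q
      using low[OF that, of "r *\<^sub>R x"] sublinear_scale[OF sub[OF that], of r x] r
      by (simp add: field_simps)
    then have "(INF q\<in>C. q (r *\<^sub>R x)) / r \<le> (INF q\<in>C. q x)"
      by (rule cINF_greatest[OF ne])
    then show "(INF q\<in>C. q (r *\<^sub>R x)) \<le> r * (INF q\<in>C. q x)"
      using r by (simp add: field_simps)
  next
    have "(\<lambda>q. q 0) ` C = (\<lambda>q. 0) ` C"
      by (intro image_cong refl) (simp add: sublinear_zero[OF sub])
    with ne show "(INF q\<in>C. q 0) = 0" by simp
  qed
qed

text \<open>
  With \<open>C = {y}\<close> and \<open>d = q y\<close> this shows that a minimal sublinear functional is odd;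
  with \<open>q\<close> a norm it provides the functional to be minimised in the separation theorem.
\<close>

lemma sublinear_below_on_convex:
  assumes q: "sublinear q" and C: "convex C" "C \<noteq> {}" and d: "\<And>c. c \<in> C \<Longrightarrow> d \<le> q c"
  obtains r where "sublinear r" "\<And>x. r x \<le> q x" "\<And>c. c \<in> C \<Longrightarrow> r (- c) \<le> - d"
proof -
  \<comment> \<open>\<open>r x\<close> is the infimum of
    \<open>q (x + t *\<^sub>R c) - t * d\<close> over \<open>t \<ge> 0\<close> and
    \<open>c \<in> C\<close>. Taking \<open>t = 0\<close> gives \<open>r x \<le> q x\<close>, and
    \<open>t = 1\<close> at the point \<open>- c\<close> gives
    \<open>r (- c) \<le> - d\<close>.\<close>
  define S where "S = {0::real..} \<times> C"
  define h where "h = (\<lambda>x (t, c). q (x + t *\<^sub>R c) - t * d)"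
  define r where "r = (\<lambda>x. INF s\<in>S. h x s)"
  have ne: "S \<noteq> {}" using C by (auto simp: S_def)
  \<comment> \<open>This bound makes the infimum finite; it is where \<open>d \<le> q c\<close>
    enters.\<close>
  have lower: "- q (- x) \<le> h x s" if sS: "s \<in> S" for x s
  proof -
    obtain t c where s: "s = (t, c)" "t \<ge> 0" "c \<in> C" using sS by (auto simp: S_def)
    have "t * d \<le> t * q c" using s d by (intro mult_left_mono) auto
    also have "\<dots> = q (t *\<^sub>R c)" using s by (simp add: sublinear_scale[OF q])
    also have "\<dots> = q ((x + t *\<^sub>R c) + - x)" by simp
    also have "\<dots> \<le> q (x + t *\<^sub>R c) + q (- x)" by (rule sublinear_add[OF q])
    finally show ?thesis by (simp add: h_def s)
  qed
  have r_le: "r x \<le> h x s" if "s \<in> S" for x s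
    unfolding r_def by (rule cINF_lower[OF bdd_belowI2 that]) (rule lower)
  have r_ge: "b \<le> r x" if "\<And>s. s \<in> S \<Longrightarrow> b \<le> h x s" for b x
    unfolding r_def by (rule cINF_greatest[OF ne that])
  have r_le_q: "r x \<le> q x" for x
  proof -
    obtain c where "c \<in> C" using C by auto
    then show ?thesis using r_le[of "(0, c)" x] by (simp add: S_def h_def)
  qed
  have "sublinear r"
  proof (rule sublinearI)
    fix x y
    have *: "r (x + y) \<le> h x s + h y s'" if s: "s \<in> S" and s': "s' \<in> S" for s s'
    proof -
      obtain t c t' c' where st: "s = (t, c)" "t \<ge> 0" "c \<in> C" "s' = (t', c')" "t' \<ge> 0" "c' \<in> C"
        using s s' by (auto simp: S_def)
      \<comment> \<open>Convexity of \<open>C\<close> merges the two directions into one with weight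
        \<open>t + t'\<close>. If both weights vanish, any point of \<open>C\<close> will
        do.\<close>
      obtain c'' where c'': "c'' \<in> C" "(t + t') *\<^sub>R c'' = t *\<^sub>R c + t' *\<^sub>R c'"
      proof (cases "t + t' = 0")
        case True
        then have "t = 0" "t' = 0" using st by auto
        then show ?thesis using that[of c] st by simp
      next
        case False
        have "(t / (t + t')) *\<^sub>R c + (t' / (t + t')) *\<^sub>R c' \<in> C"
          using st False by (intro convexD[OF C(1)]) (auto simp: add_divide_distrib[symmetric])
        then show ?thesis
          using False by (intro that) (auto simp: scaleR_add_right)
      qed
      have "r (x + y) \<le> h (x + y) (t + t', c'')"
        using c'' st by (intro r_le) (auto simp: S_def)
      also have "\<dots> = q ((x + t *\<^sub>R c) + (y + t' *\<^sub>R c')) - (t + t') * d"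
        using c'' by (simp add: h_def algebra_simps)
      also have "\<dots> \<le> h x s + h y s'"
        using sublinear_add[OF q, of "x + t *\<^sub>R c" "y + t' *\<^sub>R c'"]
        by (simp add: h_def st algebra_simps)
      finally show ?thesis .
    qed
    have "r (x + y) - h x s \<le> r y" if "s \<in> S" for s
      using *[OF that] by (intro r_ge) (simp add: algebra_simps)
    then have "r (x + y) - r y \<le> r x"
      by (intro r_ge) (simp add: algebra_simps)
    then show "r (x + y) \<le> r x + r y" by simp
  next
    fix a :: real and x assume a: "a > 0"
    have "r (a *\<^sub>R x) / a \<le> h x s" if sS: "s \<in> S" for s
    proof -
      obtain t c where s: "s = (t, c)" "t \<ge> 0" "c \<in> C" using sS by (auto simp: S_def)
      have "r (a *\<^sub>R x) \<le> h (a *\<^sub>R x) (a * t, c)"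
        using s a by (intro r_le) (auto simp: S_def)
      also have "\<dots> = q (a *\<^sub>R (x + t *\<^sub>R c)) - a * t * d"
        by (simp add: h_def algebra_simps)
      also have "\<dots> = a * h x s"
        using a sublinear_scale[OF q, of a "x + t *\<^sub>R c"] by (simp add: h_def s right_diff_distrib)
      finally show ?thesis using a by (simp add: field_simps)
    qed
    then have "r (a *\<^sub>R x) / a \<le> r x" by (rule r_ge)
    then show "r (a *\<^sub>R x) \<le> a * r x" using a by (simp add: field_simps)
  next
    have "0 \<le> r 0"
      using lower[of _ 0] by (intro r_ge) (simp add: sublinear_zero[OF q])
    then show "r 0 = 0" using r_le_q[of 0] by (simp add: sublinear_zero[OF q])
  qed
  moreover have "r (- c) \<le> - d" if "c \<in> C" for c
    using r_le[of "(1, c)" "- c"] that by (simp add: S_def h_def sublinear_zero[OF q])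
  ultimately show ?thesis using that r_le_q by blast
qed

theorem hahn_banach_sublinear:
  fixes p :: "'a::real_vector \<Rightarrow> real"
  assumes p: "sublinear p"
  obtains \<phi> where "linear \<phi>" "\<And>x. \<phi> x \<le> p x"
proof -
  define A where "A = {q. sublinear q \<and> (\<forall>x. q x \<le> p x)}"
  \<comment> \<open>The order points downwards, so the maximal element that Zorn's lemma yields is a
    minimal sublinear functional below \<open>p\<close>.\<close>
  define R where "R = (\<lambda>(q :: 'a \<Rightarrow> real) r. \<forall>x. r x \<le> q x)"
  have "partial_order_on A (relation_of R A)"
    by (rule partial_order_on_relation_ofI)
      (auto simp: R_def fun_eq_iff intro: order_trans order_antisym)
  moreover have "\<exists>u\<in>A. \<forall>a\<in>C. R a u" if "C \<in> Chains (relation_of R A)" for C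
  proof (cases "C = {}")
    case True
    then show ?thesis using p by (auto simp: A_def)
  next
    case False
    have CA: "q \<in> A" if "q \<in> C" for q
      using \<open>C \<in> Chains _\<close> that by (auto simp: Chains_def relation_of_def)
    have ch: "(\<forall>x. q x \<le> r x) \<or> (\<forall>x. r x \<le> q x)" if "q \<in> C" "r \<in> C" for q r
      using \<open>C \<in> Chains _\<close> that by (auto simp: Chains_def relation_of_def R_def)
    note inf = sublinear_INF_chain[of C p, OF False _ _ ch]
    have "sublinear (\<lambda>x. INF q\<in>C. q x)" and le: "\<And>q x. q \<in> C \<Longrightarrow> (INF q\<in>C. q x) \<le> q x"
      using CA by (auto intro!: inf simp: A_def)
    moreover have "(INF q\<in>C. q x) \<le> p x" for x
      using False le CA unfolding A_def by (metis (mono_tags, lifting) ex_in_conv mem_Collect_eq order_trans)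
    ultimately show ?thesis
      by (intro bexI[of _ "\<lambda>x. INF q\<in>C. q x"]) (auto simp: A_def R_def)
  qed
  ultimately obtain m where m: "m \<in> A" and min: "\<And>q. q \<in> A \<Longrightarrow> R m q \<Longrightarrow> q = m"
    using predicate_Zorn[of A R] by blast
  have sub: "sublinear m" and le: "\<And>x. m x \<le> p x" using m by (auto simp: A_def)
  have "m (- y) \<le> - m y" for y
  proof -
    obtain r where r: "sublinear r" "\<And>x. r x \<le> m x" "r (- y) \<le> - m y"
      using sublinear_below_on_convex[OF sub, of "{y}" "m y"] by auto
    then have "r = m"
      using le by (intro min) (auto simp: A_def R_def intro: order_trans)
    with r show ?thesis by simp
  qed
  then show ?thesis
    using that sublinear_odd_imp_linear[OF sub] le by blast
qed

text \<open>A linear functional below the \<open>r\<close> obtained from the norm does both jobs: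
  its values at \<open>x\<close> and \<open>- x\<close> give the norm bound, its value at
  \<open>- c\<close> the bound on \<open>C\<close>.\<close>

theorem hahn_banach_separation_from_zero:
  fixes C :: "'v::real_normed_vector set"
  assumes "convex C" "C \<noteq> {}" "\<And>c. c \<in> C \<Longrightarrow> d \<le> norm c"
  obtains \<psi> where "linear \<psi>" "\<And>x. \<bar>\<psi> x\<bar> \<le> norm x" "\<And>c. c \<in> C \<Longrightarrow> d \<le> \<psi> c"
proof -
  obtain r where r: "sublinear r" "\<And>x. r x \<le> norm x" "\<And>c. c \<in> C \<Longrightarrow> r (- c) \<le> - d"
    using sublinear_below_on_convex[OF sublinear_norm assms] by blast
  obtain \<psi> where \<psi>: "linear \<psi>" "\<And>x. \<psi> x \<le> r x"
    using hahn_banach_sublinear[OF r(1)] by blast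
  have "\<bar>\<psi> x\<bar> \<le> norm x" for x
    using \<psi>(2)[of x] \<psi>(2)[of "- x"] r(2)[of x] r(2)[of "- x"] linear_neg[OF \<psi>(1), of x]
    by simp
  moreover have "d \<le> \<psi> c" if "c \<in> C" for c
    using \<psi>(2)[of "- c"] r(3)[OF that] linear_neg[OF \<psi>(1), of c] by simp
  ultimately show ?thesis using that \<psi>(1) by blast
qed

section \<open>Uniform boundedness\<close>

text \<open>By Baire's theorem one of the closed sets \<open>A m\<close> that cover the space
  contains a ball. This is what later allows a weak* convergent sequence to be rescaled into the
  unit ball.\<close>

theorem uniform_boundedness:
  fixes f :: "nat \<Rightarrow> 'a::banach \<Rightarrow>\<^sub>L 'k::real_normed_vector"
  assumes bdd: "\<And>x. Bseq (\<lambda>n. f n x)"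
  shows "Bseq f"
proof -
  define A where "A m = {x. \<forall>n. norm (f n x) \<le> real m}" for m
  have "closed (A m)" for m
    unfolding A_def Collect_all_eq
    by (intro closed_INT ballI closed_Collect_le continuous_intros)
  moreover have "(\<Union>m. A m) = UNIV"
  proof -
    have "\<exists>m. x \<in> A m" for x
    proof -
      obtain K where "\<And>n. norm (f n x) \<le> K" using bdd[of x] unfolding Bseq_def by blast
      then show ?thesis
        using real_arch_simple[of K] by (auto simp: A_def intro: order_trans)
    qed
    then show ?thesis by blast
  qed
  ultimately have "\<exists>m. interior (A m) \<noteq> {}"
    using Baire_category_alt[of euclidean "range A"] completely_metrizable_space_euclidean
    by fastforce
  then obtain m x0 where "x0 \<in> interior (A m)" by blast
  then obtain e where e: "e > 0" "cball x0 e \<subseteq> A m"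
    by (meson mem_interior_cball)
  have "norm (f n) \<le> 2 * real m / e" for n
  proof (rule norm_blinfun_bound)
    fix x
    show "norm (f n x) \<le> 2 * real m / e * norm x"
    proof (cases "x = 0")
      case False
      \<comment> \<open>\<open>y\<close> has length \<open>e\<close>, so \<open>x0\<close> and
        \<open>x0 + y\<close> both lie in the ball; subtracting the two bounds \<open>m\<close>
        leaves \<open>2 * m\<close> for \<open>f n y\<close>.\<close>
      define y where "y = (e / norm x) *\<^sub>R x"
      have "x0 + y \<in> A m" "x0 \<in> A m"
        using e False by (auto intro!: subsetD[OF e(2)] simp: y_def dist_norm)
      then have "norm (f n (x0 + y)) \<le> m" "norm (f n x0) \<le> m" by (auto simp: A_def)
      then have "norm (f n y) \<le> 2 * real m"
        using norm_triangle_ineq4[of "f n (x0 + y)" "f n x0"] by (simp add: blinfun.add_right)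
      then show ?thesis
        using False e by (simp add: y_def blinfun.scaleR_right field_simps)
    qed (simp add: blinfun.zero_right)
  qed (use e in auto)
  then show ?thesis by (rule BseqI')
qed

section \<open>Convex block subsequences\<close>

text \<open>A convex combination involves only finitely many terms. Formally, the hulls of the
  finite blocks increase with \<open>M\<close>, so their union is already convex.\<close>

lemma convex_hull_tail_block:
  fixes f :: "nat \<Rightarrow> 'v::real_vector"
  assumes "y \<in> convex hull (f ` {N..})"
  obtains M where "N < M" "y \<in> convex hull (f ` {N..<M})"
proof -
  let ?U = "\<Union>M\<in>{N<..}. convex hull (f ` {N..<M})"
  have "convex ?U"
  proof (rule convexI)
    fix a b :: 'v and u v :: real
    assume a: "a \<in> ?U" and b: "b \<in> ?U" and uv: "0 \<le> u" "0 \<le> v" "u + v = 1"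
    from a b obtain M M' where M: "N < M" "a \<in> convex hull (f ` {N..<M})"
        "b \<in> convex hull (f ` {N..<M'})"
      by blast
    have "a \<in> convex hull (f ` {N..<max M M'})" "b \<in> convex hull (f ` {N..<max M M'})"
      by (rule subsetD[OF hull_mono M(2)] subsetD[OF hull_mono M(3)]; auto)+
    then have "u *\<^sub>R a + v *\<^sub>R b \<in> convex hull (f ` {N..<max M M'})"
      using uv by (intro convexD[OF convex_convex_hull])
    then show "u *\<^sub>R a + v *\<^sub>R b \<in> ?U"
      using M(1) by (intro UN_I[of "max M M'"]) auto
  qed
  moreover have "f ` {N..} \<subseteq> ?U"
  proof
    fix z assume "z \<in> f ` {N..}"
    then obtain i where "z = f i" "N \<le> i" by auto
    then show "z \<in> ?U" by (intro UN_I[of "Suc i"]) (auto intro: hull_inc)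
  qed
  ultimately have "convex hull (f ` {N..}) \<subseteq> ?U" by (rule hull_minimal[rotated])
  with assms that show ?thesis by blast
qed

lemma cbs_tendsto_zero:
  fixes f :: "nat \<Rightarrow> 'v::real_normed_vector"
  assumes small: "\<And>N e. e > 0 \<Longrightarrow> \<exists>y\<in>convex hull (f ` {N..}). norm y < e"
  obtains g where "g \<in> cbs f" "g \<longlonglongrightarrow> 0"
proof -
  have "\<exists>M>N. \<exists>y\<in>convex hull (f ` {N..<M}). norm y < e" if "e > 0" for N e
    using small[OF that, of N] convex_hull_tail_block[of _ f N] by metis
  then have "\<forall>n N. \<exists>M>N. \<exists>y\<in>convex hull (f ` {N..<M}). norm y < inverse (real (Suc n))"
    by simp
  then obtain M where M: "\<And>n N. N < M n N"
      "\<And>n N. \<exists>y\<in>convex hull (f ` {N..<M n N}). norm y < inverse (real (Suc n))"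
    by metis
  \<comment> \<open>Each block starts where the previous one ends: \<open>M n N\<close> is an end
    point for a block starting at \<open>N\<close> whose hull has an element of norm below
    \<open>1 / (n + 1)\<close>.\<close>
  define k where "k = rec_nat 0 M"
  have k: "k 0 = 0" "\<And>n. k (Suc n) = M n (k n)" by (simp_all add: k_def)
  have "\<forall>n. \<exists>y. y \<in> convex hull (f ` {k n..<k (Suc n)}) \<and> norm y < inverse (real (Suc n))"
    using M(2) unfolding k(2) by blast
  then obtain g where g: "\<And>n. g n \<in> convex hull (f ` {k n..<k (Suc n)})"
      "\<And>n. norm (g n) < inverse (real (Suc n))"
    by metis
  have "strict_mono k" by (simp add: strict_mono_Suc_iff k M)
  with k g have "g \<in> cbs f" by (auto simp: cbs_def)
  moreover have "g \<longlonglongrightarrow> 0"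
    by (rule Lim_null_comparison[OF always_eventually LIMSEQ_inverse_real_of_nat])
      (use g(2) in \<open>auto intro: less_imp_le\<close>)
  ultimately show ?thesis by (rule that)
qed

section \<open>The dual and the bidual\<close>

lemma subspace_dual: "subspace (dual sc)"
  unfolding subspace_def dual_def
  by (auto simp: blinfun.add_left blinfun.scaleR_left algebra_simps)

text \<open>The canonical image of \<open>x\<close> in the bidual; it makes weak limits comparable
  with weak* limits.\<close>

lemma evaluation_in_bidual: "(\<lambda>f. blinfun_apply f x) \<in> bidual sc"
  unfolding bidual_def
  by (auto simp: blinfun.add_left intro!: exI[of _ "norm x"] norm_blinfun[THEN order_trans])

lemma bidual_add: "\<phi> \<in> bidual sc \<Longrightarrow> f \<in> dual sc \<Longrightarrow> g \<in> dual sc \<Longrightarrow> \<phi> (f + g) = \<phi> f + \<phi> g"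
  by (auto simp: bidual_def)

lemma bidual_scaleR:
  assumes "\<phi> \<in> bidual sc" "f \<in> dual sc"
  shows "\<phi> (r *\<^sub>R f) = r *\<^sub>R \<phi> f"
proof -
  have "blinfun_mult_right (of_real r) o\<^sub>L f = r *\<^sub>R f"
    by (intro blinfun_eqI) (simp add: blinfun.scaleR_left scaleR_conv_of_real)
  with assms show ?thesis
    unfolding bidual_def by (auto simp: scaleR_conv_of_real dest!: spec[of _ "of_real r"])
qed

lemma bidual_zero: "\<phi> \<in> bidual sc \<Longrightarrow> \<phi> 0 = 0"
  using bidual_scaleR[of \<phi> sc 0 0] subspace_0[OF subspace_dual[of sc]] by simp

lemma bidual_diff:
  assumes "\<phi> \<in> bidual sc" "f \<in> dual sc" "g \<in> dual sc"
  shows "\<phi> (f - g) = \<phi> f - \<phi> g"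
  using bidual_add[OF assms(1) subspace_diff[OF subspace_dual assms(2,3)] assms(3)] by simp

lemma bidual_bound:
  assumes "\<phi> \<in> bidual sc"
  obtains C where "C > 0" "\<And>f. f \<in> dual sc \<Longrightarrow> norm (\<phi> f) \<le> C * norm f"
proof -
  obtain C where C: "\<And>f. f \<in> dual sc \<Longrightarrow> norm (\<phi> f) \<le> C * norm f"
    using assms unfolding bidual_def by blast
  have "norm (\<phi> f) \<le> max C 1 * norm f" if "f \<in> dual sc" for f
    using C[OF that] by (rule order_trans) (intro mult_right_mono; simp)
  then show ?thesis by (intro that[of "max C 1"]) auto
qed

text \<open>On the dual \<open>\<phi>\<close> is real-linear, so the preimage of a ball is convex.
  Membership in \<open>dual sc\<close> is carried along because \<open>\<phi>\<close> is controlled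
  only there.\<close>

lemma bidual_convex_hull_cball:
  assumes \<phi>: "\<phi> \<in> bidual sc" and S: "S \<subseteq> dual sc" and ball: "\<phi> ` S \<subseteq> cball z e"
    and y: "y \<in> convex hull S"
  shows "y \<in> dual sc" "\<phi> y \<in> cball z e"
proof -
  have "convex {y \<in> dual sc. \<phi> y \<in> cball z e}"
  proof (rule convexI)
    fix a b and u v :: real
    assume ab: "a \<in> {y \<in> dual sc. \<phi> y \<in> cball z e}" "b \<in> {y \<in> dual sc. \<phi> y \<in> cball z e}"
      and uv: "0 \<le> u" "0 \<le> v" "u + v = 1"
    have D: "u *\<^sub>R a \<in> dual sc" "v *\<^sub>R b \<in> dual sc"
      using ab by (auto intro: subspace_scale[OF subspace_dual])
    have "\<phi> (u *\<^sub>R a + v *\<^sub>R b) = u *\<^sub>R \<phi> a + v *\<^sub>R \<phi> b"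
      using ab D by (simp add: bidual_add[OF \<phi>] bidual_scaleR[OF \<phi>])
    moreover have "u *\<^sub>R \<phi> a + v *\<^sub>R \<phi> b \<in> cball z e"
      using ab uv by (intro convexD[OF convex_cball]) auto
    ultimately show "u *\<^sub>R a + v *\<^sub>R b \<in> {y \<in> dual sc. \<phi> y \<in> cball z e}"
      using subspace_add[OF subspace_dual D] by simp
  qed
  moreover have "S \<subseteq> {y \<in> dual sc. \<phi> y \<in> cball z e}" using S ball by auto
  ultimately have "convex hull S \<subseteq> {y \<in> dual sc. \<phi> y \<in> cball z e}"
    by (rule hull_minimal[rotated])
  then show "y \<in> dual sc" "\<phi> y \<in> cball z e" using y by auto
qed

text \<open>
  The only point where the scalar field matters: \<open>\<psi>\<close> is merely real-linear, and for complex
  scalars it has to be complexified.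
\<close>

definition bidual_dominates_linear :: "('k::real_normed_field \<Rightarrow> 'a::banach \<Rightarrow> 'a) \<Rightarrow> bool" where
  "bidual_dominates_linear sc \<longleftrightarrow>
     (\<forall>\<psi> :: ('a \<Rightarrow>\<^sub>L 'k) \<Rightarrow> real. linear \<psi> \<and> (\<forall>f. \<bar>\<psi> f\<bar> \<le> norm f) \<longrightarrow>
        (\<exists>\<phi>\<in>bidual sc. \<forall>f\<in>dual sc. \<bar>\<psi> f\<bar> \<le> norm (\<phi> f)))"

lemma bidual_dominates_linear_real:
  "bidual_dominates_linear (sc :: real \<Rightarrow> 'a::banach \<Rightarrow> 'a)"
  unfolding bidual_dominates_linear_def
proof (intro allI impI)
  fix \<psi> :: "('a \<Rightarrow>\<^sub>L real) \<Rightarrow> real"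
  assume \<psi>: "linear \<psi> \<and> (\<forall>f. \<bar>\<psi> f\<bar> \<le> norm f)"
  have "blinfun_mult_right c o\<^sub>L f = c *\<^sub>R f" for c and f :: "'a \<Rightarrow>\<^sub>L real"
    by (intro blinfun_eqI) (simp add: blinfun.scaleR_left)
  then have "\<psi> \<in> bidual sc"
    using \<psi> unfolding bidual_def by (auto simp: linear_add linear_scale intro!: exI[of _ 1])
  then show "\<exists>\<phi>\<in>bidual sc. \<forall>f\<in>dual sc. \<bar>\<psi> f\<bar> \<le> norm (\<phi> f)" by auto
qed

text \<open>The usual complexification \<open>\<phi> f = \<psi> f - \<i> * \<psi> (\<i> * f)\<close>
  has real part \<open>\<psi>\<close>, hence dominates it.\<close>

lemma bidual_dominates_linear_complex:
  "bidual_dominates_linear (sc :: complex \<Rightarrow> 'a::banach \<Rightarrow> 'a)"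
  unfolding bidual_dominates_linear_def
proof (intro allI impI)
  fix \<psi> :: "('a \<Rightarrow>\<^sub>L complex) \<Rightarrow> real"
  assume \<psi>: "linear \<psi> \<and> (\<forall>f. \<bar>\<psi> f\<bar> \<le> norm f)"
  define J where "J f = blinfun_mult_right \<i> o\<^sub>L f" for f :: "'a \<Rightarrow>\<^sub>L complex"
  have J_add: "J (f + g) = J f + J g" for f g
    unfolding J_def by (intro blinfun_eqI) (simp add: blinfun.add_left algebra_simps)
  \<comment> \<open>With \<open>J\<close> as multiplication by \<open>\<i>\<close>, these identities
    reduce complex homogeneity of \<open>\<phi>\<close> to real linearity of
    \<open>\<psi>\<close>.\<close>
  have mult: "blinfun_mult_right c o\<^sub>L f = Re c *\<^sub>R f + Im c *\<^sub>R J f"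
      "J (blinfun_mult_right c o\<^sub>L f) = Re c *\<^sub>R J f - Im c *\<^sub>R f" for c f
    unfolding J_def
    by (intro blinfun_eqI;
        simp add: blinfun.add_left blinfun.diff_left blinfun.scaleR_left complex_eq_iff)+
  have norm_J: "norm (J f) \<le> norm f" for f
    unfolding J_def
    by (intro norm_blinfun_bound) (auto simp: norm_mult intro: norm_blinfun)
  define \<phi> where "\<phi> f = Complex (\<psi> f) (- \<psi> (J f))" for f
  have "\<phi> (f + g) = \<phi> f + \<phi> g" for f g
    using \<psi> by (simp add: \<phi>_def J_add linear_add complex_eq_iff)
  moreover have "\<phi> (blinfun_mult_right c o\<^sub>L f) = c * \<phi> f" for c f
    using \<psi> by (simp add: \<phi>_def mult(2)) 
      (simp add: mult(1) linear_add linear_diff linear_scale complex_eq_iff algebra_simps)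
  moreover have "norm (\<phi> f) \<le> 2 * norm f" for f
  proof -
    have "norm (\<phi> f) \<le> \<bar>\<psi> f\<bar> + \<bar>\<psi> (J f)\<bar>"
      using cmod_le[of "\<phi> f"] by (simp add: \<phi>_def)
    also have "\<dots> \<le> norm f + norm (J f)" using \<psi> by (intro add_mono) auto
    finally show ?thesis using norm_J[of f] by simp
  qed
  ultimately have "\<phi> \<in> bidual sc" unfolding bidual_def by blast
  moreover have "\<bar>\<psi> f\<bar> \<le> norm (\<phi> f)" for f
    using abs_Re_le_cmod[of "\<phi> f"] by (simp add: \<phi>_def)
  ultimately show "\<exists>\<phi>\<in>bidual sc. \<forall>f\<in>dual sc. \<bar>\<psi> f\<bar> \<le> norm (\<phi> f)" by blast
qed

section \<open>The Grothendieck property\<close>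

text \<open>If the hull of some tail stayed at distance \<open>e\<close> from 0, a separating
  \<open>\<psi>\<close> would be at least \<open>e\<close> on that tail, and a bidual element
  dominating \<open>\<psi>\<close> would contradict weak nullness.\<close>

lemma mazur_cbs:
  assumes dom: "bidual_dominates_linear sc" and f: "range f \<subseteq> dual sc" and lim: "weak_lim sc f 0"
  obtains g where "g \<in> cbs f" "g \<longlonglongrightarrow> 0"
proof (rule cbs_tendsto_zero)
  fix N and e :: real assume e: "e > 0"
  show "\<exists>y\<in>convex hull (f ` {N..}). norm y < e"
  proof (rule ccontr)
    assume "\<not> ?thesis"
    then have "\<And>c. c \<in> convex hull (f ` {N..}) \<Longrightarrow> e \<le> norm c" by force
    then obtain \<psi> where \<psi>: "linear \<psi>" "\<And>x. \<bar>\<psi> x\<bar> \<le> norm x"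
        "\<And>c. c \<in> convex hull (f ` {N..}) \<Longrightarrow> e \<le> \<psi> c"
      using hahn_banach_separation_from_zero[OF convex_convex_hull, of "f ` {N..}" e] by auto
    obtain \<phi> where \<phi>: "\<phi> \<in> bidual sc" "\<And>g. g \<in> dual sc \<Longrightarrow> \<bar>\<psi> g\<bar> \<le> norm (\<phi> g)"
      using dom \<psi>(1,2) unfolding bidual_dominates_linear_def by blast
    have "(\<lambda>n. \<phi> (f n)) \<longlonglongrightarrow> 0"
      using lim \<phi>(1) bidual_zero[OF \<phi>(1)] by (auto simp: weak_lim_def)
    then have "\<forall>\<^sub>F n in sequentially. norm (\<phi> (f n)) < e"
      using e by (simp add: tendsto_iff)
    then obtain n where n: "n \<ge> N" "norm (\<phi> (f n)) < e"
      using eventually_happens'[OF _ eventually_conj[OF eventually_ge_at_top[of N]]] by auto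
    have "e \<le> \<psi> (f n)" using n by (intro \<psi>(3) hull_inc) auto
    then show False using \<phi>(2)[of "f n"] n f by (auto simp: image_subset_iff)
  qed
qed

text \<open>An empty supremum in \<open>ereal\<close> would be minus infinity, so the zero sequence
  is exhibited as a member of the index set.\<close>

lemma G_const_nonneg:
  fixes sc :: "'b::real_normed_field \<Rightarrow> 'a::banach \<Rightarrow> 'a"
  shows "0 \<le> G_const sc"
proof -
  have "(\<lambda>_. 0) \<in> weak_star_null_ball sc"
    using subspace_0[OF subspace_dual[of sc]]
    by (auto simp: weak_star_null_ball_def weak_star_lim_def)
  moreover have "0 \<le> (INF g \<in> cbs (\<lambda>_. 0 :: 'a \<Rightarrow>\<^sub>L 'b). limsup (\<lambda>n. ereal (norm (g n))))"
    by (intro INF_greatest le_Limsup) auto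
  ultimately show ?thesis unfolding G_const_def by (intro SUP_upper2[of "\<lambda>_. 0"])
qed

lemma G_const_eq_0I:
  assumes "\<And>f. f \<in> weak_star_null_ball sc \<Longrightarrow> \<exists>g\<in>cbs f. g \<longlonglongrightarrow> 0"
  shows "G_const sc = 0"
proof (rule antisym[OF _ G_const_nonneg])
  show "G_const sc \<le> 0"
    unfolding G_const_def
  proof (rule SUP_least)
    fix f assume "f \<in> weak_star_null_ball sc"
    with assms obtain g where g: "g \<in> cbs f" "g \<longlonglongrightarrow> 0" by blast
    have "(\<lambda>n. ereal (norm (g n))) \<longlonglongrightarrow> ereal 0"
      using tendsto_norm_zero[OF g(2)] by (simp only: tendsto_ereal)
    then have "limsup (\<lambda>n. ereal (norm (g n))) = 0"
      by (simp add: lim_imp_Limsup zero_ereal_def)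
    then show "(INF g \<in> cbs f. limsup (\<lambda>n. ereal (norm (g n)))) \<le> 0"
      using g(1) by (metis INF_lower)
  qed
qed

text \<open>A \<open>limsup\<close> below \<open>e\<close> yields a block of norm below
  \<open>e\<close>; one such block is enough for the contradiction in the next lemma.\<close>

lemma cbs_norm_small:
  assumes "G_const sc = 0" "f \<in> weak_star_null_ball sc" "e > 0"
  obtains g n where "g \<in> cbs f" "norm (g n) < e"
proof -
  have "(INF g \<in> cbs f. limsup (\<lambda>n. ereal (norm (g n)))) \<le> G_const sc"
    unfolding G_const_def by (rule SUP_upper[OF assms(2)])
  also have "\<dots> < ereal e" using assms by simp
  finally obtain g where g: "g \<in> cbs f" "limsup (\<lambda>n. ereal (norm (g n))) < ereal e"
    by (auto simp: INF_less_iff)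
  then have "\<forall>\<^sub>F n in sequentially. ereal (norm (g n)) < ereal e"
    by (intro Limsup_lessD)
  then show ?thesis using that g(1) by (auto simp: eventually_sequentially)
qed

text \<open>Scalars of modulus at least \<open>e\<close> do not form a convex set, so the values of
  \<open>\<phi>\<close> are first confined to a small ball around a cluster point. The class
  \<open>heine_borel\<close> provides that cluster point.\<close>

lemma weakly_null_if_G_const_eq_0:
  fixes sc :: "'k::{real_normed_field,heine_borel} \<Rightarrow> 'a::banach \<Rightarrow> 'a"
  assumes G: "G_const sc = 0" and f: "f \<in> weak_star_null_ball sc"
  shows "weak_lim sc f 0"
  unfolding weak_lim_def
proof
  fix \<phi> assume \<phi>: "\<phi> \<in> bidual sc"
  have "f n \<in> dual sc \<inter> cball 0 1" for n
    using f unfolding weak_star_null_ball_def by blast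
  then have fD: "\<And>n. f n \<in> dual sc" and f1: "\<And>n. norm (f n) \<le> 1"
    by auto
  obtain C where C: "C > 0" "\<And>f. f \<in> dual sc \<Longrightarrow> norm (\<phi> f) \<le> C * norm f"
    using bidual_bound[OF \<phi>] by blast
  have "(\<lambda>n. \<phi> (f n)) \<longlonglongrightarrow> 0"
  proof (rule ccontr)
    assume "\<not> (\<lambda>n. \<phi> (f n)) \<longlonglongrightarrow> 0"
    then obtain e where e: "e > 0" "\<exists>\<^sub>F n in sequentially. e \<le> norm (\<phi> (f n))"
      by (auto simp: tendsto_iff frequently_def not_le)
    then have "infinite {n. e \<le> norm (\<phi> (f n))}"
      by (simp add: frequently_cofinite cofinite_eq_sequentially[symmetric])
    then obtain s :: "nat \<Rightarrow> nat" where s: "strict_mono s" "\<And>n. e \<le> norm (\<phi> (f (s n)))"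
      using infinite_enumerate by blast
    have "bounded (range (\<lambda>n. \<phi> (f (s n))))"
    proof (rule boundedI)
      fix z assume "z \<in> range (\<lambda>n. \<phi> (f (s n)))"
      then obtain n where n: "z = \<phi> (f (s n))" by auto
      have "norm z \<le> C * norm (f (s n))" using C fD n by simp
      also have "\<dots> \<le> C * 1" using C f1 by (intro mult_left_mono) auto
      finally show "norm z \<le> C" by simp
    qed
    from bounded_imp_convergent_subsequence[OF this]
    obtain z t where t: "strict_mono t" "(\<lambda>n. \<phi> (f (s (t n)))) \<longlonglongrightarrow> z"
      by (auto simp: o_def)
    have z: "e \<le> norm z"
      by (rule tendsto_lowerbound[OF tendsto_norm[OF t(2)]]) (auto simp: s)
    obtain N where N: "\<And>n. n \<ge> N \<Longrightarrow> dist (\<phi> (f (s (t n)))) z < e / 2"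
      using t(2) e(1) unfolding lim_sequentially by (meson half_gt_zero)
    \<comment> \<open>The shift by \<open>N\<close> places every value \<open>\<phi> (h n)\<close>
      within \<open>e / 2\<close> of \<open>z\<close>, so every convex block is covered, wherever it
      starts.\<close>
    define h where "h n = f (s (t (n + N)))" for n
    have mono: "strict_mono (\<lambda>n. s (t (n + N)))"
      using s(1) t(1) by (simp add: strict_mono_def)
    have hD: "\<And>n. h n \<in> dual sc" by (simp add: h_def fD)
    have "(\<lambda>n. h n x) \<longlonglongrightarrow> 0" for x
      using f LIMSEQ_subseq_LIMSEQ[OF _ mono, of "\<lambda>n. f n x" 0]
      by (auto simp: h_def o_def weak_star_null_ball_def weak_star_lim_def)
    then have "h \<in> weak_star_null_ball sc"
      using fD f1 by (auto simp: weak_star_null_ball_def weak_star_lim_def h_def)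
    \<comment> \<open>The threshold is chosen so that \<open>C * norm (g n) < e / 2\<close>, whereas
      the ball around \<open>z\<close> forces
      \<open>norm (\<phi> (g n)) \<ge> e / 2\<close>.\<close>
    then obtain g n where g: "g \<in> cbs h" "norm (g n) < e / (2 * C)"
      using cbs_norm_small[OF G, of h "e / (2 * C)"] e(1) C(1) by auto
    obtain S where S: "g n \<in> convex hull (h ` S)"
      using g(1) by (auto simp: cbs_def)
    have "\<phi> ` h ` S \<subseteq> cball z (e / 2)"
      using N by (auto simp: h_def dist_commute less_imp_le)
    from bidual_convex_hull_cball[OF \<phi> _ this S]
    have gD: "g n \<in> dual sc" and "\<phi> (g n) \<in> cball z (e / 2)" using hD by auto
    then have "norm z - norm (\<phi> (g n)) \<le> e / 2"
      using norm_triangle_ineq2[of z "\<phi> (g n)"] by (simp add: dist_norm)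
    then have "e / 2 \<le> norm (\<phi> (g n))" using z by simp
    also have "\<dots> \<le> C * norm (g n)" by (rule C(2)[OF gD])
    also have "\<dots> < e / 2" using g(2) C(1) by (simp add: field_simps)
    finally show False by simp
  qed
  then show "(\<lambda>n. \<phi> (f n)) \<longlonglongrightarrow> \<phi> 0" by (simp add: bidual_zero[OF \<phi>])
qed

text \<open>Subtracting the weak* limit and dividing by a uniform norm bound reduces an arbitrary
  weak* convergent sequence to a weak* null one in the unit ball.\<close>

lemma grothendieck_spaceI:
  assumes null: "\<And>f. f \<in> weak_star_null_ball sc \<Longrightarrow> weak_lim sc f 0"
  shows "grothendieck_space sc"
  unfolding grothendieck_space_def
proof (intro allI impI)
  fix f assume "range f \<subseteq> dual sc \<and> (\<exists>l\<in>dual sc. weak_star_lim f l)"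
  then obtain l where f: "\<And>n. f n \<in> dual sc" and l: "l \<in> dual sc"
    and lim: "\<And>x. (\<lambda>n. f n x) \<longlonglongrightarrow> l x"
    by (auto simp: weak_star_lim_def)
  have "Bseq (\<lambda>n. f n - l)"
  proof (intro uniform_boundedness convergent_imp_Bseq)
    fix x
    show "convergent (\<lambda>n. (f n - l) x)"
      using LIM_zero[OF lim[of x]] by (auto simp: blinfun.diff_left convergent_def)
  qed
  then obtain K where K: "K > 0" "\<And>n. norm (f n - l) \<le> K"
    unfolding Bseq_def by blast
  define h where "h n = inverse K *\<^sub>R (f n - l)" for n
  have hD: "h n \<in> dual sc" for n
    unfolding h_def
    by (intro subspace_scale[OF subspace_dual] subspace_diff[OF subspace_dual] f l)
  have "(\<lambda>n. h n x) \<longlonglongrightarrow> 0" for x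
    using tendsto_scaleR[OF tendsto_const[of "inverse K"] LIM_zero[OF lim[of x]]]
    by (simp add: h_def blinfun.scaleR_left blinfun.diff_left)
  moreover have "norm (h n) \<le> 1" for n
    using K(1) K(2)[of n] by (simp add: h_def inverse_eq_divide)
  ultimately have h: "weak_lim sc h 0"
    using hD by (intro null) (auto simp: weak_star_null_ball_def weak_star_lim_def)
  have "weak_lim sc f l"
    unfolding weak_lim_def
  proof
    fix \<phi> assume \<phi>: "\<phi> \<in> bidual sc"
    have "(\<lambda>n. K *\<^sub>R \<phi> (h n)) \<longlonglongrightarrow> K *\<^sub>R \<phi> 0"
      using h \<phi> by (intro tendsto_scaleR tendsto_const) (auto simp: weak_lim_def)
    moreover have "K *\<^sub>R \<phi> (h n) = \<phi> (f n) - \<phi> l" for n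
      using K(1) bidual_scaleR[OF \<phi> subspace_diff[OF subspace_dual f l], of "inverse K" n]
        bidual_diff[OF \<phi> f l]
      by (simp add: h_def)
    ultimately show "(\<lambda>n. \<phi> (f n)) \<longlonglongrightarrow> \<phi> l"
      by (simp add: bidual_zero[OF \<phi>] LIM_zero_iff)
  qed
  with l show "\<exists>l\<in>dual sc. weak_lim sc f l" by blast
qed

text \<open>The Grothendieck property promises only some weak limit; testing it on point evaluations
  identifies it with the weak* limit 0.\<close>

lemma grothendieck_space_weakly_null:
  assumes "grothendieck_space sc" "f \<in> weak_star_null_ball sc"
  shows "weak_lim sc f 0"
proof -
  have f: "range f \<subseteq> dual sc" "\<And>x. (\<lambda>n. f n x) \<longlonglongrightarrow> 0" "weak_star_lim f 0"
    using assms(2) by (auto simp: weak_star_null_ball_def weak_star_lim_def)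
  then obtain l where l: "weak_lim sc f l"
    using assms(1) subspace_0[OF subspace_dual[of sc]] unfolding grothendieck_space_def by blast
  have "l x = 0" for x
    using l evaluation_in_bidual[of x sc] f(2)[of x]
    by (auto simp: weak_lim_def intro: LIMSEQ_unique)
  then have "l = 0" by (intro blinfun_eqI) simp
  with l show ?thesis by simp
qed

text \<open>Treats real and complex scalars at once; the field enters through
  \<open>bidual_dominates_linear\<close> and the compactness of bounded closed sets of
  scalars.\<close>

theorem grothendieck_space_iff_G_const_eq_0:
  fixes sc :: "'k::{real_normed_field,heine_borel} \<Rightarrow> 'a::banach \<Rightarrow> 'a"
  assumes "bidual_dominates_linear sc"
  shows "grothendieck_space sc \<longleftrightarrow> G_const sc = 0"
proof
  assume "grothendieck_space sc"
  then show "G_const sc = 0"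
  proof (intro G_const_eq_0I)
    fix f assume f: "f \<in> weak_star_null_ball sc"
    then have "range f \<subseteq> dual sc" by (auto simp: weak_star_null_ball_def)
    then show "\<exists>g\<in>cbs f. g \<longlonglongrightarrow> 0"
      using mazur_cbs[OF assms _ grothendieck_space_weakly_null[OF \<open>grothendieck_space sc\<close> f]]
      by blast
  qed
next
  assume "G_const sc = 0"
  then show "grothendieck_space sc"
    by (intro grothendieck_spaceI weakly_null_if_G_const_eq_0)
qed

theorem theorem4p5:
  fixes scaleC :: "complex \<Rightarrow> 'b::banach \<Rightarrow> 'b"
  shows "(infinite_dimensional (scaleR :: real \<Rightarrow> 'a::banach \<Rightarrow> 'a) \<longrightarrow>
            (grothendieck_space (scaleR :: real \<Rightarrow> 'a \<Rightarrow> 'a) \<longleftrightarrow>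
             G_const (scaleR :: real \<Rightarrow> 'a \<Rightarrow> 'a) = 0)) \<and>
         (banach_over scaleC \<and> infinite_dimensional scaleC \<longrightarrow>
            (grothendieck_space scaleC \<longleftrightarrow> G_const scaleC = 0))"
  using grothendieck_space_iff_G_const_eq_0[OF bidual_dominates_linear_real]
    grothendieck_space_iff_G_const_eq_0[OF bidual_dominates_linear_complex]
  by blast

end
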